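(* Let $X$ be a set and let $\mathscr{A}$ and $\mathscr{B}$ be collections of families of subsets of $X$. Then $X$ satisfies the principle $\mathbf{CS}_{fin}(\mathscr{A},\mathscr{B})$ if and only if $X$ satisfies the principle $\mathbf{DS}_{fin}(\mathscr{A}^c,\mathscr{B}^c)$.
   Context: For $U\subseteq X$, $U^c=X\setminus U$; for a family $\mathcal{U}$ of subsets of $X$, $\mathcal{U}^c=\{U^c:U\in\mathcal{U}\}$; for a collection $\mathscr{U}$ of families of subsets of $X$, $\mathscr{U}^c=\{\mathcal{U}^c:\mathcal{U}\in\mathscr{U}\}$. For a set $Y$, $[Y]^{<\omega}$ is the collection of all finite subsets of $Y$ (including $\emptyset$). For the empty family of subsets of $X$, $\bigcup\emptyset=\emptyset$ and $\bigcap\emptyset=X$. For collections $\mathscr{A},\mathscr{B}$ of families of subsets of $X$: $\mathbf{CS}_{fin}(\mathscr{A},\mathscr{B})$: for any sequence $\{\mathcal{U}_n:n\in\omega\}$ of elements of $\mathscr{A}$ there is a sequence $\{\mathcal{U}_n^f:n\in\omega\}$ such that, for each $n\in\omega$, $\mathcal{U}_n^f=\{U_n^1,\dots,U_n^{k_n}\}$ is a finite subset of $\mathcal{U}_n$, and $\bigcup\{\mathcal{V}_n^i:n\in\omega\text{ and }i\in\{1,\dots,k_n\}\}\in\mathscr{B}$, where $\mathcal{V}_n^i=\{\bigcup\mathcal{V}:\mathcal{V}\in[\mathcal{U}_n]^{<\omega}\text{ and }U_n^i\cap V\neq\emptyset\text{ for each }V\in\mathcal{V}\}$. $\mathbf{DS}_{fin}(\mathscr{A},\mathscr{B})$: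 for any sequence $\{\mathcal{D}_n:n\in\omega\}$ of elements of $\mathscr{A}$ there is a sequence $\{\mathcal{D}_n^f:n\in\omega\}$ such that, for each $n\in\omega$, $\mathcal{D}_n^f=\{D_n^1,\dots,D_n^{k_n}\}$ is a finite subset of $\mathcal{D}_n$, and $\bigcup\{\mathcal{F}_n^i:n\in\omega\text{ and }i\in\{1,\dots,k_n\}\}\in\mathscr{B}$, where $\mathcal{F}_n^i=\{\bigcap\mathcal{F}:\mathcal{F}\in[\mathcal{D}_n]^{<\omega}\text{ and }(D_n^i)^c\cap E^c\neq\emptyset\text{ for each }E\in\mathcal{F}\}$. *)

theory Defs
  imports Main
begin

text \<open>The ambient set \<open>X\<close> is an explicit carrier; complements are relative to \<open>X\<close>.\<close>

definition family_compl :: "'a set \<Rightarrow> 'a set set \<Rightarrow> 'a set set" where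
  "family_compl X \<U> = {X - U |U. U \<in> \<U>}"

definition collection_compl :: "'a set \<Rightarrow> 'a set set set \<Rightarrow> 'a set set set" where
  "collection_compl X \<A> = {family_compl X \<U> |\<U>. \<U> \<in> \<A>}"

text \<open>
  In the two principles, \<open>F n\<close> is the finite selection from the \<open>n\<close>-th family, possibly empty.
  The big union runs over the members of \<open>F n\<close> directly, instead of over the indices of an
  enumeration of it. \<open>X\<close> is not a parameter of \<open>CS_fin\<close> because no complement or empty
  intersection occurs there.
\<close>

definition union_family :: "'a set set \<Rightarrow> 'a set \<Rightarrow> 'a set set" where
  "union_family \<U> U = {\<Union>\<V> |\<V>. \<V> \<in> Fpow \<U> \<and> (\<forall>V\<in>\<V>. U \<inter> V \<noteq> {})}"

definition CS_fin :: "'a set set set \<Rightarrow> 'a set set set \<Rightarrow> bool" where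
  "CS_fin \<A> \<B> \<longleftrightarrow>
    (\<forall>\<U> :: nat \<Rightarrow> 'a set set. (\<forall>n. \<U> n \<in> \<A>) \<longrightarrow>
      (\<exists>F :: nat \<Rightarrow> 'a set set. (\<forall>n. F n \<in> Fpow (\<U> n)) \<and>
        (\<Union>n. \<Union>U\<in>F n. union_family (\<U> n) U) \<in> \<B>))"

text \<open>
  \<open>X \<inter> \<Inter>\<F>\<close> implements the convention that the intersection of the empty family is \<open>X\<close>
  (the library has \<open>\<Inter>{} = UNIV\<close>); for a nonempty family of subsets of \<open>X\<close> it is just \<open>\<Inter>\<F>\<close>.
\<close>

definition inter_family :: "'a set \<Rightarrow> 'a set set \<Rightarrow> 'a set \<Rightarrow> 'a set set" where
  "inter_family X \<D> D =
    {X \<inter> \<Inter>\<F> |\<F>. \<F> \<in> Fpow \<D> \<and> (\<forall>E\<in>\<F>. (X - D) \<inter> (X - E) \<noteq> {})}"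

definition DS_fin :: "'a set \<Rightarrow> 'a set set set \<Rightarrow> 'a set set set \<Rightarrow> bool" where
  "DS_fin X \<A> \<B> \<longleftrightarrow>
    (\<forall>\<D> :: nat \<Rightarrow> 'a set set. (\<forall>n. \<D> n \<in> \<A>) \<longrightarrow>
      (\<exists>F :: nat \<Rightarrow> 'a set set. (\<forall>n. F n \<in> Fpow (\<D> n)) \<and>
        (\<Union>n. \<Union>D\<in>F n. inter_family X (\<D> n) D) \<in> \<B>))"

end

theory Submission
  imports Defs
begin

text \<open>
  On subsets of \<open>X\<close>, relative complementation is an involution that exchanges unions with
  intersections taken in \<open>X\<close>. It therefore gives a bijection between the finite subfamilies of
  \<open>\<U>\<close> and those of \<open>\<U>\<^sup>c\<close>, and by De Morgan it carries the family generated by a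
  selected \<open>U\<close> (finite unions of members meeting \<open>U\<close>) onto the dual family generated by \<open>X - U\<close>
  (\<open>inter_family_compl\<close>). So a selection from a sequence in \<open>\<A>\<close> produces a member of \<open>\<B>\<close>
  exactly when the complementary selection produces a member of \<open>\<B>\<^sup>c\<close>
  (\<open>inter_family_compl_UN\<close>, \<open>family_compl_in_collection_compl_iff\<close>).
\<close>

lemma family_compl_eq_image: "family_compl X \<U> = (\<lambda>U. X - U) ` \<U>"
  by (auto simp: family_compl_def)

lemma family_compl_involution:
  assumes "\<U> \<subseteq> Pow X"
  shows "family_compl X (family_compl X \<U>) = \<U>"
proof -
  have "X - (X - U) = U" if "U \<in> \<U>" for U
    using assms that by blast
  then show ?thesis
    by (simp add: family_compl_eq_image image_image)
qed

lemma family_compl_UN: "family_compl X (\<Union>i\<in>I. \<U> i) = (\<Union>i\<in>I. family_compl X (\<U> i))"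
  by (simp add: family_compl_eq_image image_UN)

lemma family_compl_Fpow:
  assumes "\<V> \<in> Fpow \<U>"
  shows "family_compl X \<V> \<in> Fpow (family_compl X \<U>)"
  using assms by (auto simp: Fpow_def family_compl_eq_image)

lemma Fpow_family_compl:
  "Fpow (family_compl X \<U>) = family_compl X ` Fpow \<U>"
proof
  show "Fpow (family_compl X \<U>) \<subseteq> family_compl X ` Fpow \<U>"
  proof
    fix \<F> assume "\<F> \<in> Fpow (family_compl X \<U>)"
    then have "finite \<F>" "\<F> \<subseteq> (\<lambda>U. X - U) ` \<U>"
      by (auto simp: Fpow_def family_compl_eq_image)
    then obtain \<V> where "\<V> \<subseteq> \<U>" "finite \<V>" "\<F> = (\<lambda>U. X - U) ` \<V>"
      by (meson finite_subset_image)
    then show "\<F> \<in> family_compl X ` Fpow \<U>"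
      by (auto simp: Fpow_def family_compl_eq_image)
  qed
qed (auto intro: family_compl_Fpow)

lemma union_family_subset_Pow:
  assumes "\<U> \<subseteq> Pow X"
  shows "union_family \<U> U \<subseteq> Pow X"
  using assms by (fastforce simp: union_family_def Fpow_def)

lemma inter_family_compl:
  assumes "\<U> \<subseteq> Pow X" and "U \<subseteq> X"
  shows "inter_family X (family_compl X \<U>) (X - U) = family_compl X (union_family \<U> U)"
proof -
  have meet: "(\<forall>E\<in>family_compl X \<V>. (X - (X - U)) \<inter> (X - E) \<noteq> {}) \<longleftrightarrow> (\<forall>V\<in>\<V>. U \<inter> V \<noteq> {})"
    if "\<V> \<in> Fpow \<U>" for \<V>
  proof -
    have "(X - (X - U)) \<inter> (X - (X - V)) = U \<inter> V" if "V \<in> \<V>" for V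
      using assms that \<open>\<V> \<in> Fpow \<U>\<close> by (auto simp: Fpow_def)
    then show ?thesis
      by (simp add: family_compl_eq_image)
  qed
  have de_morgan: "X \<inter> \<Inter>(family_compl X \<V>) = X - \<Union>\<V>" for \<V>
    by (auto simp: family_compl_eq_image)
  have "inter_family X (family_compl X \<U>) (X - U) =
      {X \<inter> \<Inter>(family_compl X \<V>) |\<V>. \<V> \<in> Fpow \<U> \<and>
        (\<forall>E\<in>family_compl X \<V>. (X - (X - U)) \<inter> (X - E) \<noteq> {})}"
    unfolding inter_family_def Fpow_family_compl by blast
  also have "\<dots> = {X - \<Union>\<V> |\<V>. \<V> \<in> Fpow \<U> \<and> (\<forall>V\<in>\<V>. U \<inter> V \<noteq> {})}"
    unfolding de_morgan using meet by blast
  also have "\<dots> = family_compl X (union_family \<U> U)"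
    unfolding family_compl_def union_family_def by blast
  finally show ?thesis .
qed

lemma inter_family_compl_UN:
  assumes "\<And>n. \<U> n \<subseteq> Pow X" and "\<And>n. F n \<in> Fpow (\<U> n)"
  shows "(\<Union>n. \<Union>D\<in>family_compl X (F n). inter_family X (family_compl X (\<U> n)) D) =
    family_compl X (\<Union>n. \<Union>U\<in>F n. union_family (\<U> n) U)"
proof -
  have "inter_family X (family_compl X (\<U> n)) (X - U) = family_compl X (union_family (\<U> n) U)"
    if "U \<in> F n" for n U
    using assms that by (intro inter_family_compl) (auto simp: Fpow_def)
  then have "(\<Union>D\<in>family_compl X (F n). inter_family X (family_compl X (\<U> n)) D) =
      family_compl X (\<Union>U\<in>F n. union_family (\<U> n) U)" for n
    by (simp add: family_compl_UN family_compl_eq_image[of X "F n"])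
  then show ?thesis
    by (simp add: family_compl_UN)
qed

lemma family_compl_in_collection_compl_iff:
  assumes "\<B> \<subseteq> Pow (Pow X)" and "\<W> \<subseteq> Pow X"
  shows "family_compl X \<W> \<in> collection_compl X \<B> \<longleftrightarrow> \<W> \<in> \<B>"
proof
  assume "family_compl X \<W> \<in> collection_compl X \<B>"
  then obtain \<W>' where "\<W>' \<in> \<B>" "family_compl X \<W> = family_compl X \<W>'"
    by (auto simp: collection_compl_def)
  then show "\<W> \<in> \<B>"
    using assms family_compl_involution by (metis PowD subsetD)
qed (auto simp: collection_compl_def)

lemma finite_selection_compl_iff:
  assumes "\<B> \<subseteq> Pow (Pow X)" and "\<And>n. \<U> n \<subseteq> Pow X"
  shows "(\<exists>F. (\<forall>n. F n \<in> Fpow (\<U> n)) \<and> (\<Union>n. \<Union>U\<in>F n. union_family (\<U> n) U) \<in> \<B>) \<longleftrightarrow>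
    (\<exists>G. (\<forall>n. G n \<in> Fpow (family_compl X (\<U> n))) \<and>
      (\<Union>n. \<Union>D\<in>G n. inter_family X (family_compl X (\<U> n)) D) \<in> collection_compl X \<B>)"
    (is "(\<exists>F. ?sel F \<and> ?W F \<in> \<B>) \<longleftrightarrow> (\<exists>G. ?sel' G \<and> ?W' G \<in> _)")
proof -
  have key: "?W' (\<lambda>n. family_compl X (F n)) \<in> collection_compl X \<B> \<longleftrightarrow> ?W F \<in> \<B>"
    if "?sel F" for F
  proof -
    have "?W F \<subseteq> Pow X"
      using union_family_subset_Pow[OF assms(2)] by blast
    then show ?thesis
      using inter_family_compl_UN[of \<U> X F] assms(2) that
        family_compl_in_collection_compl_iff[OF assms(1)] by simp
  qed
  show ?thesis
  proof
    assume "\<exists>F. ?sel F \<and> ?W F \<in> \<B>"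
    then obtain F where F: "?sel F" "?W F \<in> \<B>" by blast
    then have "?sel' (\<lambda>n. family_compl X (F n))"
      by (simp add: family_compl_Fpow)
    with F key[of F] show "\<exists>G. ?sel' G \<and> ?W' G \<in> collection_compl X \<B>"
      by (intro exI[of _ "\<lambda>n. family_compl X (F n)"]) simp
  next
    assume "\<exists>G. ?sel' G \<and> ?W' G \<in> collection_compl X \<B>"
    then obtain G where G: "?sel' G" "?W' G \<in> collection_compl X \<B>" by blast
    then have "\<forall>n. \<exists>\<V>. \<V> \<in> Fpow (\<U> n) \<and> G n = family_compl X \<V>"
      unfolding Fpow_family_compl by blast
    then obtain F where F: "?sel F" "\<And>n. G n = family_compl X (F n)"
      by metis
    with G(2) key[of F] show "\<exists>F. ?sel F \<and> ?W F \<in> \<B>"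
      by (intro exI[of _ F]) simp
  qed
qed

text \<open>Sequences in \<open>\<A>\<^sup>c\<close> are the termwise complements of sequences in \<open>\<A>\<close>.\<close>

lemma all_sequences_collection_compl_iff:
  "(\<forall>\<D>. (\<forall>n::nat. \<D> n \<in> collection_compl X \<A>) \<longrightarrow> P \<D>) \<longleftrightarrow>
    (\<forall>\<U>. (\<forall>n. \<U> n \<in> \<A>) \<longrightarrow> P (\<lambda>n. family_compl X (\<U> n)))"
proof (intro iffI allI impI)
  fix \<U> :: "nat \<Rightarrow> 'a set set"
  assume "\<forall>\<D>. (\<forall>n. \<D> n \<in> collection_compl X \<A>) \<longrightarrow> P \<D>" "\<forall>n. \<U> n \<in> \<A>"
  moreover from this have "\<forall>n. family_compl X (\<U> n) \<in> collection_compl X \<A>"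
    by (auto simp: collection_compl_def)
  ultimately show "P (\<lambda>n. family_compl X (\<U> n))"
    by simp
next
  fix \<D> :: "nat \<Rightarrow> 'a set set"
  assume *: "\<forall>\<U>. (\<forall>n. \<U> n \<in> \<A>) \<longrightarrow> P (\<lambda>n. family_compl X (\<U> n))"
  assume "\<forall>n. \<D> n \<in> collection_compl X \<A>"
  then have "\<forall>n. \<exists>\<V>. \<V> \<in> \<A> \<and> \<D> n = family_compl X \<V>"
    by (auto simp: collection_compl_def)
  then obtain \<U> where "\<forall>n. \<U> n \<in> \<A>" "\<And>n. \<D> n = family_compl X (\<U> n)"
    by metis
  moreover from this have "\<D> = (\<lambda>n. family_compl X (\<U> n))" by blast
  ultimately show "P \<D>" using * by blast
qed

theorem theorem3p9:
  fixes X :: "'a set" and \<A> \<B> :: "'a set set set"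
  assumes "\<A> \<subseteq> Pow (Pow X)" and "\<B> \<subseteq> Pow (Pow X)"
  shows "CS_fin \<A> \<B> \<longleftrightarrow> DS_fin X (collection_compl X \<A>) (collection_compl X \<B>)"
  unfolding CS_fin_def DS_fin_def all_sequences_collection_compl_iff
proof (intro all_cong1 imp_cong refl)
  fix \<U> :: "nat \<Rightarrow> 'a set set"
  assume "\<forall>n. \<U> n \<in> \<A>"
  then have "\<U> n \<subseteq> Pow X" for n
    using assms(1) by blast
  then show "(\<exists>F. (\<forall>n. F n \<in> Fpow (\<U> n)) \<and> (\<Union>n. \<Union>U\<in>F n. union_family (\<U> n) U) \<in> \<B>) \<longleftrightarrow>
    (\<exists>G. (\<forall>n. G n \<in> Fpow (family_compl X (\<U> n))) \<and>
      (\<Union>n. \<Union>D\<in>G n. inter_family X (family_compl X (\<U> n)) D) \<in> collection_compl X \<B>)"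
    by (rule finite_selection_compl_iff[OF assms(2)])
qed

end
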